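(* Let $d,m\ge 1$ be integers, let $A_1,\dots,A_m$ be positive semidefinite $d\times d$ matrices, let $\lambda_1,\dots,\lambda_m\ge 0$ be real numbers, and let $M$ be a real number such that \[ \sum_{i=1}^m \lambda_i A_i=\mathrm{Id}_d,\qquad \sum_{i=1}^m\lambda_i=1,\qquad \|A_i\|\le M\quad\text{for all } i\in\{1,\dots,m\}. \] Then there exists a single infinite sequence of indices $i_1,i_2,\dots\in\{1,\dots,m\}$ such that for every integer $k\ge 1$, \[ \left\|\frac1k\sum_{r=1}^k A_{i_r}-\mathrm{Id}_d\right\|\le \begin{cases} 2\,\dfrac{M\ln(2d)}{k}, & \text{if } k\le M\ln(2d),\\[2ex] 3\,\sqrt{\dfrac{M\ln(2d)}{k}}, & \text{if } k> M\ln(2d). \end{cases} \]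
   Context: Here $\|\cdot\|$ denotes the operator norm (largest singular value), $\mathrm{Id}_d$ is the $d\times d$ identity matrix, and $\ln$ is the natural logarithm. Positive semidefinite matrices are understood to be self-adjoint (real symmetric or complex Hermitian). The indices $i_r$ may repeat, and the same sequence works for all $k$ simultaneously. *)

theory Defs
  imports "HOL-Analysis.Analysis"
begin

definition psd_real :: "real^'d^'d \<Rightarrow> bool" where
  "psd_real A \<longleftrightarrow> transpose A = A \<and> (\<forall>x. 0 \<le> x \<bullet> (A *v x))"

definition conj_transpose :: "complex^'d^'d \<Rightarrow> complex^'d^'d" where
  "conj_transpose A = (\<chi> i j. cnj (A $ j $ i))"

text \<open>The quadratic form of a Hermitian matrix is real-valued, so taking the real part
  loses nothing. It is spelled out because the library's \<open>\<bullet>\<close> on complex vectors is only the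
  real part of the Hermitian inner product.\<close>

definition psd_complex :: "complex^'d^'d \<Rightarrow> bool" where
  "psd_complex A \<longleftrightarrow>
     conj_transpose A = A \<and> (\<forall>x. 0 \<le> Re (\<Sum>i\<in>UNIV. cnj (x $ i) * (A *v x) $ i))"

text \<open>The library norm on \<open>'a^'d\<close> is the Euclidean one, also for complex entries, so for
  real and complex matrices this is the spectral norm (largest singular value).\<close>

definition opnorm :: "'a::real_normed_field^'d^'d \<Rightarrow> real" where
  "opnorm A = onorm (\<lambda>x. A *v x)"

end

theory Submission
  imports Defs
begin

text \<open>
  Write \<open>S\<^sub>k\<close> for the sum of the first \<open>k\<close> chosen matrices minus \<open>k Id\<close>. The index \<open>i\<^sub>k\<close> is chosen greedily
  to keep small \<open>tr exp (\<theta>\<^sub>k S\<^sub>k) + tr exp (- \<theta>\<^sub>k S\<^sub>k)\<close>, where \<open>M \<theta>\<^sub>k = min 1 (sqrt (M ln (2 d) / k))\<close>.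
  Averaging with the weights \<open>\<lambda>\<^sub>i\<close> shows that some choice multiplies this quantity by at most
  \<open>exp (M \<theta>\<^sub>k\<^sup>2)\<close>. Passing to a smaller \<open>\<theta>\<close> is harmless by the inequality between power means, so
  the norm of \<open>S\<^sub>k\<close> is at most the sum of \<open>M \<theta>\<^sub>j\<close> over \<open>j \<le> k\<close> plus \<open>ln (2 d) / \<theta>\<^sub>k\<close>, which is the bound.

  Instead of the Golden-Thompson inequality, one step is controlled by a scalar inequality in the
  differences of eigenvalues of consecutive matrices, weighted with the squared inner products of
  their eigenvectors; this uses \<open>A\<^sup>2 \<le> M A\<close> for positive semidefinite \<open>A\<close> of norm at most \<open>M\<close>.
\<close>

section \<open>A scalar inequality for the exponential function\<close>

lemma exp_le_quadratic_neg:
  fixes y :: real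
  assumes "y \<le> 0"
  shows "exp y \<le> 1 + y + y\<^sup>2 / 2"
proof -
  obtain t where t: "exp y = (\<Sum>m<3. y ^ m / fact m) + exp t / fact 3 * y ^ 3"
    using Maclaurin_exp_le[of y 3] by blast
  have "y ^ 3 \<le> 0" using assms by (simp add: power_le_zero_eq)
  then have "exp t / fact 3 * y ^ 3 \<le> 0" by (intro mult_nonneg_nonpos) auto
  then show ?thesis using t by (simp add: numeral_3_eq_3 power2_eq_square)
qed

text \<open>On the unit interval each power from the third on is at most \<open>y\<^sup>2\<close>.
  The Taylor coefficients 1/2 + 1/6 + 1/24 and the remainder 2.72/120 add up to less than
  3/4.\<close>

lemma exp_le_quadratic_unit:
  fixes y :: real
  assumes "0 \<le> y" "y \<le> 1"
  shows "exp y \<le> 1 + y + 3 / 4 * y\<^sup>2"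
proof -
  obtain t where t: "\<bar>t\<bar> \<le> \<bar>y\<bar>" "exp y = (\<Sum>m<5. y ^ m / fact m) + exp t / fact 5 * y ^ 5"
    using Maclaurin_exp_le[of y 5] by blast
  have "exp t \<le> exp 1" using t(1) assms by simp
  then have et: "exp t \<le> 272 / 100" using e_less_272 by linarith
  have p: "y ^ n \<le> y ^ 2" if "2 \<le> n" for n using power_decreasing[OF that assms] .
  have "exp t * y ^ 5 \<le> 272 / 100 * y ^ 2"
    by (rule mult_mono) (use et p[of 5] assms in auto)
  moreover have "exp y = 1 + y + y ^ 2 / 2 + y ^ 3 / 6 + y ^ 4 / 24 + exp t * y ^ 5 / 120"
    using t(2) by (simp add: eval_nat_numeral fact_numeral field_simps)
  ultimately show ?thesis using p[of 3] p[of 4] zero_le_power2[of y] by linarith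
qed

text \<open>Collecting the terms with \<open>exp y\<close> leaves
  \<open>exp y * (1 - (y\<^sup>2 - y) / 4)\<close> to be bounded by a quadratic. The bracket is at
  most \<open>exp (- (y\<^sup>2 - y) / 4)\<close>, and the resulting exponent is
  \<open>1 + u\<close>, concave in \<open>y\<close>.\<close>

lemma exp_le_quadratic_large:
  fixes y :: real
  assumes "1 \<le> y"
  shows "exp y \<le> 1 + y + y\<^sup>2 + (exp y - 1) * (y\<^sup>2 - y) / 4"
proof -
  define u where "u = (y - 1) * (4 - y) / 4"
  have "1 - (y\<^sup>2 - y) / 4 \<le> exp (- ((y\<^sup>2 - y) / 4))" using exp_ge_add_one_self[of "- ((y\<^sup>2 - y) / 4)"] by simp
  then have "exp y * (1 - (y\<^sup>2 - y) / 4) \<le> exp y * exp (- ((y\<^sup>2 - y) / 4))" by simp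
  also have "\<dots> = exp 1 * exp u" unfolding u_def
    by (simp flip: exp_add) (simp add: power2_eq_square field_simps)
  also have "\<dots> \<le> 1 + 5 / 4 * y + 3 / 4 * y\<^sup>2"
  proof (cases "y \<le> 2")
    case True
    \<comment> \<open>Bounding \<open>4 - y\<close> by 3 makes \<open>u\<close> at most the linear
      term \<open>s\<close>, which stays in the unit interval for \<open>y \<le> 2\<close>.\<close>
    define s where "s = 3 / 4 * (y - 1)"
    have s: "0 \<le> s" "s \<le> 1" using True assms by (auto simp: s_def)
    have us: "u \<le> s" using mult_left_mono[of "4 - y" 3 "y - 1"] assms by (simp add: s_def u_def)
    have "exp u \<le> exp s" using us by simp
    also have "\<dots> \<le> 1 + s + 3 / 4 * s\<^sup>2" using s by (rule exp_le_quadratic_unit)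
    finally have "exp 1 * exp u \<le> 272 / 100 * (1 + s + 3 / 4 * s\<^sup>2)"
      using e_less_272 by (intro mult_mono) auto
    also have "\<dots> \<le> 1 + 5 / 4 * y + 3 / 4 * y\<^sup>2"
    proof -
      have y: "y = 1 + 4 / 3 * s" by (simp add: s_def field_simps)
      have "1 + 5 / 4 * y + 3 / 4 * y\<^sup>2 = 3 + 11 / 3 * s + 4 / 3 * s\<^sup>2"
        unfolding y by (simp add: power2_eq_square field_simps)
      moreover have "s\<^sup>2 \<le> s" using s by (simp add: power2_eq_square mult_left_le)
      moreover have "272 / 100 * (1 + s + 3 / 4 * s\<^sup>2) = 68 / 25 + 68 / 25 * s + 51 / 25 * s\<^sup>2"
        by (simp add: field_simps)
      ultimately show ?thesis using s by linarith
    qed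
    finally show ?thesis .
  next
    case False
    \<comment> \<open>The maximum of \<open>u\<close> is attained at \<open>y = 5/2\<close>; this
      crude constant suffices since the quadratic is at least its value at 2.\<close>
    have "u \<le> 9 / 16" unfolding u_def using zero_le_power2[of "2 * y - 5"] by (simp add: power2_eq_square field_simps)
    then have "exp u \<le> exp (9 / 16)" by simp
    also have "\<dots> \<le> 1 + 9 / 16 + 3 / 4 * (9 / 16)\<^sup>2" by (rule exp_le_quadratic_unit) auto
    finally have "exp 1 * exp u \<le> 272 / 100 * (1 + 9 / 16 + 3 / 4 * (9 / 16)\<^sup>2)"
      using e_less_272 by (intro mult_mono) auto
    also have "\<dots> \<le> 1 + 5 / 4 * 2 + 3 / 4 * 2\<^sup>2" by (simp add: power2_eq_square)
    also have "\<dots> \<le> 1 + 5 / 4 * y + 3 / 4 * y\<^sup>2"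
      using False power_mono[of 2 y 2] by simp
    finally show ?thesis .
  qed
  finally show ?thesis by (simp add: field_simps)
qed

text \<open>The right-hand side is \<open>1 + (1 + z) y + (3/4 + exp y / 4) (y\<^sup>2 - z y)\<close>. With \<open>y\<close> a difference of
  an eigenvalue of \<open>Q\<close> and one of \<open>P\<close>, the last summand disappears on taking traces, because
  \<open>(Q - P)\<^sup>2 \<le> z (Q - P)\<close>.\<close>

lemma exp_le_exp_quadratic:
  fixes y z :: real
  assumes "\<bar>z\<bar> \<le> 1"
  shows "exp y \<le> 1 + y + y\<^sup>2 + (exp y - 1) * (y\<^sup>2 - z * y) / 4"
proof (cases "y \<le> 0")
  case True
  \<comment> \<open>For either sign of \<open>y\<close>, the right-hand side is smallest at
    \<open>z = 1\<close>, because \<open>y * (exp y - 1)\<close> is nonnegative. So only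
    \<open>z = 1\<close> has to be examined.\<close>
  have "y\<^sup>2 - z * y \<le> y\<^sup>2 - y" 
    using assms True mult_right_mono_neg[of z 1 y] mult_right_mono_neg[of "-1" z y] by linarith
  then have "(1 - exp y) * (y\<^sup>2 - z * y) \<le> (1 - exp y) * (y\<^sup>2 - y)"
    using True by (intro mult_left_mono) auto
  also have "\<dots> = (1 - exp y) * y\<^sup>2 + (- y) * (1 - exp y)" by (simp add: algebra_simps)
  also have "\<dots> \<le> 1 * y\<^sup>2 + (- y) * (- y)"
    using True exp_ge_add_one_self[of y]
    by (intro add_mono mult_right_mono mult_left_mono) (simp_all add: algebra_simps)
  finally have "- (2 * y\<^sup>2) \<le> (exp y - 1) * (y\<^sup>2 - z * y)" by (simp add: power2_eq_square algebra_simps)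
  then show ?thesis using exp_le_quadratic_neg[OF True] by simp
next
  case False
  have "y\<^sup>2 - y \<le> y\<^sup>2 - z * y" using assms False mult_right_mono[of z 1 y] by linarith
  then have step: "(exp y - 1) * (y\<^sup>2 - y) \<le> (exp y - 1) * (y\<^sup>2 - z * y)"
    using False by (intro mult_left_mono) auto
  have "exp y \<le> 1 + y + y\<^sup>2 + (exp y - 1) * (y\<^sup>2 - y) / 4"
  proof (cases "1 \<le> y")
    case True then show ?thesis by (rule exp_le_quadratic_large)
  next
    case F: False
    \<comment> \<open>For \<open>y\<close> between 0 and 1 the last term is at least
      \<open>- y\<^sup>2 / 4\<close>, which leaves exactly the coefficient 3/4 of the unit-interval
      bound.\<close>
    have "(1 - y) \<le> exp (- y)" using exp_ge_add_one_self[of "- y"] by simp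
    then have "(1 - y) * exp y \<le> 1" by (simp add: exp_minus field_simps)
    then have "(exp y - 1) * (1 - y) \<le> y" by (simp add: algebra_simps)
    then have "((exp y - 1) * (1 - y)) * y \<le> y * y" using False by (intro mult_right_mono) auto
    then have "- (y\<^sup>2) \<le> (exp y - 1) * (y\<^sup>2 - y)" by (simp add: power2_eq_square algebra_simps)
    then show ?thesis using exp_le_quadratic_unit[of y] F False by simp
  qed
  then show ?thesis using step by simp
qed

section \<open>Orthonormal eigenbases of self-adjoint operators\<close>

text \<open>The trace of g(f) is the sum of \<open>g (e v)\<close> over \<open>v \<in> B\<close>,
  and all traces below are written in this way. Multiplicities are counted because distinct members
  of \<open>B\<close> may share a value of \<open>e\<close>.\<close>

definition eigenbasis :: "('a::euclidean_space \<Rightarrow> 'a) \<Rightarrow> 'a set \<Rightarrow> ('a \<Rightarrow> real) \<Rightarrow> bool" where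
  "eigenbasis f B e \<longleftrightarrow> finite B \<and> pairwise orthogonal B \<and> span B = UNIV \<and>
     (\<forall>v\<in>B. norm v = 1 \<and> f v = e v *\<^sub>R v)"

text \<open>A maximizer \<open>v\<close> of the Rayleigh quotient on the unit sphere of
  \<open>V\<close> works: the form of \<open>h = mu - f\<close> is nonnegative on \<open>V\<close>
  and vanishes at \<open>v\<close>. Perturbing \<open>v\<close> in the direction \<open>h v\<close>
  then forces \<open>h v = 0\<close>.\<close>

lemma exists_eigenvector_subspace:
  fixes f :: "'a::euclidean_space \<Rightarrow> 'a"
  assumes f: "linear f" and sa: "\<And>x y. f x \<bullet> y = x \<bullet> f y"
    and V: "subspace V" "f ` V \<subseteq> V" "V \<noteq> {0}"
  obtains v mu where "v \<in> V" "norm v = 1" "f v = mu *\<^sub>R v"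
proof -
  let ?S = "sphere 0 1 \<inter> V"
  obtain w where w: "w \<in> V" "w \<noteq> 0" using V subspace_0 by blast
  have "w /\<^sub>R norm w \<in> ?S" using w V(1) by (simp add: subspace_scale)
  then have ne: "?S \<noteq> {}" by blast
  have cmp: "compact ?S" using closed_subspace[OF V(1)] by (simp add: compact_Int_closed)
  have "continuous_on ?S (\<lambda>x. x \<bullet> f x)"
    using f by (intro continuous_intros linear_continuous_on) (simp add: linear_conv_bounded_linear)
  then obtain v where v: "v \<in> ?S" and vmax: "\<And>x. x \<in> ?S \<Longrightarrow> x \<bullet> f x \<le> v \<bullet> f v"
    using continuous_attains_sup[OF cmp ne] by blast
  define mu where "mu = v \<bullet> f v"
  define h where "h x = mu *\<^sub>R x - f x" for x
  have hpos: "0 \<le> x \<bullet> h x" if x: "x \<in> V" for x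
  proof (cases "x = 0")
    case False
    have "x /\<^sub>R norm x \<in> ?S" using x False V(1) by (simp add: subspace_scale)
    from vmax[OF this] have "(x \<bullet> f x) / (norm x)\<^sup>2 \<le> mu"
      using f by (simp add: mu_def linear_cmul power2_eq_square field_simps)
    then have "x \<bullet> f x \<le> mu * (norm x)\<^sup>2" using False by (simp add: field_simps)
    then show ?thesis by (simp add: h_def inner_diff_right dot_square_norm)
  qed simp
  have vv: "v \<bullet> v = 1" using v by (simp add: dot_square_norm)
  have v0: "v \<bullet> h v = 0" using vv by (simp add: h_def inner_diff_right mu_def)
  then have v0': "h v \<bullet> v = 0" by (simp add: inner_commute)
  have hlin: "h (v + t *\<^sub>R x) = h v + t *\<^sub>R h x" for t x
    using f by (simp add: h_def linear_add linear_cmul algebra_simps)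
  have hsa: "h x \<bullet> y = x \<bullet> h y" for x y
    by (simp add: h_def inner_diff_right inner_diff_left sa)
  have hV: "h v \<in> V" using v V by (auto simp: h_def intro!: subspace_diff subspace_scale)
  define q where "q = h v \<bullet> h (h v)"
  define n where "n = h v \<bullet> h v"
  have quad: "0 \<le> 2 * t * n + t\<^sup>2 * q" for t
  proof -
    have "0 \<le> (v + t *\<^sub>R h v) \<bullet> h (v + t *\<^sub>R h v)"
      using v hV V(1) by (intro hpos subspace_add subspace_scale) auto
    also have "\<dots> = 2 * t * n + t\<^sup>2 * q"
      unfolding hlin inner_add_left inner_add_right inner_scaleR_left inner_scaleR_right v0
        hsa[of v, symmetric] v0' n_def q_def by (simp add: power2_eq_square distrib_left)
    finally show ?thesis .
  qed
  have q0: "0 \<le> q" unfolding q_def using hpos[OF hV] .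
  have n0: "0 \<le> n" by (simp add: n_def)
  \<comment> \<open>This makes the quadratic negative unless \<open>n = 0\<close>; the denominator
    \<open>q + 1\<close> is positive even when \<open>q = 0\<close>.\<close>
  define t where "t = - n / (q + 1)"
  have t: "t * (q + 1) = - n" using q0 by (simp add: t_def)
  have "0 \<le> (q + 1)\<^sup>2 * (2 * t * n + t\<^sup>2 * q)"
    by (intro mult_nonneg_nonneg quad zero_le_power2)
  also have "\<dots> = 2 * n * (q + 1) * (t * (q + 1)) + q * (t * (q + 1))\<^sup>2"
    by (simp add: power2_eq_square algebra_simps)
  also have "\<dots> = - (n\<^sup>2 * (q + 2))" unfolding t by (simp add: power2_eq_square algebra_simps)
  finally have "n\<^sup>2 * (q + 2) \<le> 0" by simp
  then have "n = 0" using q0 n0 by (simp add: mult_le_0_iff)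
  then have "h v = 0" by (simp add: n_def)
  then show ?thesis using that[of v mu] v by (simp add: h_def)
qed

text \<open>Induction on the dimension: split off one eigenvector \<open>v\<close>. By
  self-adjointness its orthogonal complement \<open>W\<close> in \<open>V\<close> is again
  invariant.\<close>

lemma orthonormal_eigenvectors_subspace:
  fixes f :: "'a::euclidean_space \<Rightarrow> 'a"
  assumes f: "linear f" and sa: "\<And>x y. f x \<bullet> y = x \<bullet> f y"
  shows "subspace V \<Longrightarrow> f ` V \<subseteq> V \<Longrightarrow>
    \<exists>B e. finite B \<and> pairwise orthogonal B \<and> span B = V \<and> (\<forall>v\<in>B. norm v = 1 \<and> f v = e v *\<^sub>R v)"
proof (induction "dim V" arbitrary: V rule: less_induct)
  case less
  show ?case
  proof (cases "V = {0}")
    case True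
    then show ?thesis by (intro exI[of _ "{}"]) auto
  next
    case False
    obtain v mu where v: "v \<in> V" "norm v = 1" "f v = mu *\<^sub>R v"
      using exists_eigenvector_subspace[OF f sa less.prems False] .
    define W where "W = V \<inter> {x. v \<bullet> x = 0}"
    have W: "subspace W" unfolding W_def
      using less.prems(1) subspace_hyperplane[of v] by (simp add: subspace_inter)
    have fW: "f ` W \<subseteq> W"
      using less.prems(2) v(3) by (auto simp: W_def sa[symmetric])
    have "v \<notin> W" using v(2) by (auto simp: W_def)
    then have "W \<subset> V" using v(1) unfolding W_def by blast
    then have "dim W < dim V" using W less.prems(1) by (metis dim_psubset span_eq_iff)
    from less.hyps[OF this W fW] obtain B e where
      B: "finite B" "pairwise orthogonal B" "span B = W" "\<And>v. v \<in> B \<Longrightarrow> norm v = 1 \<and> f v = e v *\<^sub>R v"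
      by blast
    have BW: "B \<subseteq> W" using B(3) span_superset by blast
    have "V \<subseteq> span (insert v B)"
    proof
      fix x assume x: "x \<in> V"
      have "x - (v \<bullet> x) *\<^sub>R v \<in> W"
        using x v less.prems(1) by (simp add: W_def inner_diff_right dot_square_norm subspace_diff subspace_scale)
      then show "x \<in> span (insert v B)" unfolding span_insert B(3) by blast
    qed
    moreover have "span (insert v B) \<subseteq> V"
      using BW v(1) less.prems(1) by (intro span_minimal) (auto simp: W_def)
    ultimately have sp: "span (insert v B) = V" by blast
    have ort: "pairwise orthogonal (insert v B)"
      using B(2) BW by (auto simp: pairwise_insert orthogonal_def W_def inner_commute)
    have "\<forall>w\<in>insert v B. norm w = 1 \<and> f w = (e(v := mu)) w *\<^sub>R w"
      using v B(4) BW \<open>v \<notin> W\<close> by auto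
    then show ?thesis using B(1) sp ort by (intro exI[of _ "insert v B"]) blast
  qed
qed

lemma exists_eigenbasis:
  fixes f :: "'a::euclidean_space \<Rightarrow> 'a"
  assumes "linear f" "\<And>x y. f x \<bullet> y = x \<bullet> f y"
  obtains B e where "eigenbasis f B e"
  using orthonormal_eigenvectors_subspace[OF assms, of UNIV] unfolding eigenbasis_def by auto

lemma eigenbasis_parseval:
  assumes "eigenbasis f B e"
  shows "(\<Sum>v\<in>B. (x \<bullet> v) * (y \<bullet> v)) = x \<bullet> y"
proof -
  have "(\<Sum>v\<in>B. (x \<bullet> v) *\<^sub>R v) = x"
    using assms by (intro orthonormal_basis_expand) (auto simp: eigenbasis_def)
  then have "x \<bullet> y = (\<Sum>v\<in>B. (x \<bullet> v) *\<^sub>R v) \<bullet> y" by simp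
  also have "\<dots> = (\<Sum>v\<in>B. (x \<bullet> v) * (y \<bullet> v))" by (simp add: inner_sum_left inner_commute[of y])
  finally show ?thesis by simp
qed

lemma eigenbasis_card:
  assumes "eigenbasis (f :: 'a::euclidean_space \<Rightarrow> 'a) B e"
  shows "card B = DIM('a)"
proof -
  have "0 \<notin> B" using assms by (auto simp: eigenbasis_def)
  then have "independent B" using assms by (intro pairwise_orthogonal_independent) (auto simp: eigenbasis_def)
  then show ?thesis using assms dim_span_eq_card_independent[of B] by (simp add: eigenbasis_def)
qed

lemma eigenbasis_uminus:
  "eigenbasis f B e \<Longrightarrow> eigenbasis (\<lambda>x. - f x) B (\<lambda>v. - e v)"
  by (auto simp: eigenbasis_def)

lemma eigenbasis_scaleR:
  "eigenbasis f B e \<Longrightarrow> eigenbasis (\<lambda>x. t *\<^sub>R f x) B (\<lambda>v. t * e v)"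
  by (auto simp: eigenbasis_def)

section \<open>Exponential trace inequalities\<close>

text \<open>In trace form: tr exp Q \<le> tr (exp P (1 + (1 + z) D)), given D^2 \<le> z D. The sign
  of \<open>z\<close> may be either, so that both adding and subtracting a positive semidefinite
  operator are covered.\<close>

lemma eigenbasis_sum_exp_le:
  fixes P Q D :: "'a::euclidean_space \<Rightarrow> 'a"
  assumes P: "eigenbasis P B a" and Q: "eigenbasis Q C c"
    and Psa: "\<And>x y. P x \<bullet> y = x \<bullet> P y" and Qsa: "\<And>x y. Q x \<bullet> y = x \<bullet> Q y"
    and D: "\<And>x. D x = Q x - P x"
    and z: "\<bar>z\<bar> \<le> 1" and Dz: "\<And>x. D x \<bullet> D x \<le> z * (x \<bullet> D x)"
  shows "(\<Sum>w\<in>C. exp (c w)) \<le> (\<Sum>v\<in>B. exp (a v) * (1 + (1 + z) * (v \<bullet> D v)))"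
proof -
  \<comment> \<open>\<open>W\<close> is doubly stochastic, and \<open>P\<close>, \<open>Q\<close>, \<open>D\<close> enter only through \<open>W\<close>-weighted sums over
    pairs of eigenvalues, so that a scalar inequality can be integrated.\<close>
  define W where "W v w = (v \<bullet> w)\<^sup>2" for v w :: 'a
  define x where "x v w = c w - a v" for v w
  have Dvw: "D v \<bullet> w = x v w * (v \<bullet> w)" if "v \<in> B" "w \<in> C" for v w
    using that P Q by (simp add: D inner_diff_left Qsa x_def eigenbasis_def left_diff_distrib)
  have Dwv: "D w \<bullet> v = x v w * (v \<bullet> w)" if "v \<in> B" "w \<in> C" for v w
    using that P Q by (simp add: D inner_diff_left Psa x_def eigenbasis_def left_diff_distrib inner_commute[of w v])
  have nB: "v \<bullet> v = 1" if "v \<in> B" for v using P that by (simp add: eigenbasis_def dot_square_norm)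
  have nC: "w \<bullet> w = 1" if "w \<in> C" for w using Q that by (simp add: eigenbasis_def dot_square_norm)
  have W0: "0 \<le> W v w" for v w by (simp add: W_def)
  \<comment> \<open>By Parseval, the moments of order 0, 1 and 2 of \<open>x\<close> along a row or
    column of \<open>W\<close> are 1, the quadratic form of \<open>D\<close> and the squared norm of
    its image.\<close>
  have rB0: "(\<Sum>w\<in>C. W v w) = 1" if "v \<in> B" for v
    using eigenbasis_parseval[OF Q, of v v] nB[OF that] by (simp add: W_def power2_eq_square)
  have rC0: "(\<Sum>v\<in>B. W v w) = 1" if "w \<in> C" for w
    using eigenbasis_parseval[OF P, of w w] nC[OF that] by (simp add: W_def power2_eq_square inner_commute)
  have rB1: "(\<Sum>w\<in>C. W v w * x v w) = v \<bullet> D v" if "v \<in> B" for v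
    using eigenbasis_parseval[OF Q, of v "D v"] that
    by (simp add: W_def power2_eq_square Dvw mult_ac)
  have rB2: "(\<Sum>w\<in>C. W v w * (x v w)\<^sup>2) = D v \<bullet> D v" if "v \<in> B" for v
    using eigenbasis_parseval[OF Q, of "D v" "D v"] that
    by (simp add: W_def power2_eq_square Dvw mult_ac)
  have rC1: "(\<Sum>v\<in>B. W v w * x v w) = w \<bullet> D w" if "w \<in> C" for w
    using eigenbasis_parseval[OF P, of w "D w"] that
    by (simp add: W_def power2_eq_square Dwv mult_ac inner_commute[of w])
  have rC2: "(\<Sum>v\<in>B. W v w * (x v w)\<^sup>2) = D w \<bullet> D w" if "w \<in> C" for w
    using eigenbasis_parseval[OF P, of "D w" "D w"] that
    by (simp add: W_def power2_eq_square Dwv mult_ac)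
  define q where "q v w = (x v w)\<^sup>2 - z * x v w" for v w
  have qB: "(\<Sum>w\<in>C. W v w * q v w) \<le> 0" if "v \<in> B" for v
    using Dz[of v] rB1[OF that] rB2[OF that]
    by (simp add: q_def algebra_simps sum_subtractf flip: sum_distrib_left)
  have qC: "(\<Sum>v\<in>B. W v w * q v w) \<le> 0" if "w \<in> C" for w
    using Dz[of w] rC1[OF that] rC2[OF that]
    by (simp add: q_def algebra_simps sum_subtractf flip: sum_distrib_left)
  \<comment> \<open>The remainder is split so that each multiple of \<open>q\<close> carries a
    factor depending on one index only. It can then be pulled out of the row sums, respectively the
    column sums, of \<open>W v w * q v w\<close>, all of which are nonpositive.\<close>
  have pt: "exp (c w) \<le> exp (a v) * (1 + (1 + z) * x v w) + 3 / 4 * exp (a v) * q v w + 1 / 4 * exp (c w) * q v w" for v w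
  proof -
    have "exp (a v) * exp (x v w) \<le> exp (a v) * (1 + x v w + (x v w)\<^sup>2 + (exp (x v w) - 1) * ((x v w)\<^sup>2 - z * x v w) / 4)"
      using exp_le_exp_quadratic[OF z] by simp
    moreover have e: "exp (c w) = exp (a v) * exp (x v w)" by (simp add: x_def flip: exp_add)
    ultimately show ?thesis unfolding e q_def by (simp add: field_simps)
  qed
  have "(\<Sum>w\<in>C. exp (c w)) = (\<Sum>w\<in>C. \<Sum>v\<in>B. W v w * exp (c w))"
    using rC0 by (simp flip: sum_distrib_right)
  also have "\<dots> \<le> (\<Sum>w\<in>C. \<Sum>v\<in>B. W v w * (exp (a v) * (1 + (1 + z) * x v w) + 3 / 4 * exp (a v) * q v w + 1 / 4 * exp (c w) * q v w))"
    by (intro sum_mono mult_left_mono pt W0)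
  also have "\<dots> = (\<Sum>w\<in>C. \<Sum>v\<in>B. W v w * (exp (a v) * (1 + (1 + z) * x v w)))
      + (\<Sum>w\<in>C. \<Sum>v\<in>B. W v w * (3 / 4 * exp (a v) * q v w))
      + (\<Sum>w\<in>C. \<Sum>v\<in>B. W v w * (1 / 4 * exp (c w) * q v w))"
    by (simp add: distrib_left sum.distrib)
  also have "(\<Sum>w\<in>C. \<Sum>v\<in>B. W v w * (1 / 4 * exp (c w) * q v w)) = (\<Sum>w\<in>C. 1 / 4 * exp (c w) * (\<Sum>v\<in>B. W v w * q v w))"
    unfolding sum_distrib_left by (intro sum.cong refl) simp
  also have "\<dots> \<le> 0" using qC by (intro sum_nonpos) (simp add: mult_nonneg_nonpos)
  also have "(\<Sum>w\<in>C. \<Sum>v\<in>B. W v w * (3 / 4 * exp (a v) * q v w)) = (\<Sum>v\<in>B. 3 / 4 * exp (a v) * (\<Sum>w\<in>C. W v w * q v w))"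
    unfolding sum_distrib_left by (subst sum.swap) (intro sum.cong refl, simp)
  also have "\<dots> \<le> 0" using qB by (intro sum_nonpos) (simp add: mult_nonneg_nonpos)
  also have "(\<Sum>w\<in>C. \<Sum>v\<in>B. W v w * (exp (a v) * (1 + (1 + z) * x v w)))
      = (\<Sum>v\<in>B. exp (a v) * ((\<Sum>w\<in>C. W v w) + (1 + z) * (\<Sum>w\<in>C. W v w * x v w)))"
    by (subst sum.swap) (simp only: sum_distrib_left flip: sum.distrib, intro sum.cong refl, simp add: algebra_simps)
  also have "\<dots> = (\<Sum>v\<in>B. exp (a v) * (1 + (1 + z) * (v \<bullet> D v)))"
    by (intro sum.cong refl) (simp add: rB0 rB1)
  finally show ?thesis by simp
qed

text \<open>After division by \<open>exp (\<theta> * s)\<close> the hypothesis says that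
  \<open>2 * card B\<close> exponentials have mean at most 1. By convexity
  \<open>exp (p * t)\<close> is at most \<open>1 + p * (exp t - 1)\<close> for
  \<open>p = \<theta>' / \<theta>\<close>, so the mean stays at most 1 and the same \<open>s\<close>
  serves for \<open>\<theta>'\<close>.\<close>

lemma sum_exp_smaller_scale:
  fixes e :: "'a \<Rightarrow> real"
  assumes fin: "finite B" and th: "0 \<le> \<theta>'" "\<theta>' \<le> \<theta>" "0 < \<theta>"
    and le: "(\<Sum>v\<in>B. exp (\<theta> * e v) + exp (- (\<theta> * e v))) \<le> 2 * card B * exp (\<theta> * s)"
  shows "(\<Sum>v\<in>B. exp (\<theta>' * e v) + exp (- (\<theta>' * e v))) \<le> 2 * card B * exp (\<theta>' * s)"
proof -
  define p where "p = \<theta>' / \<theta>"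
  have p: "0 \<le> p" "p \<le> 1" "\<theta>' = p * \<theta>" using th by (auto simp: p_def)
  have bern: "exp (p * t) \<le> 1 + p * (exp t - 1)" for t :: real
    using convex_onD[OF exp_convex, of p 0 t] p by (simp add: algebra_simps)
  have "exp (- (\<theta>' * s)) * (\<Sum>v\<in>B. exp (\<theta>' * e v) + exp (- (\<theta>' * e v)))
      = (\<Sum>v\<in>B. exp (p * (\<theta> * e v - \<theta> * s)) + exp (p * (- (\<theta> * e v) - \<theta> * s)))"
    by (simp add: sum_distrib_left p(3) distrib_left right_diff_distrib exp_diff exp_minus field_simps)
  also have "\<dots> \<le> (\<Sum>v\<in>B. (1 + p * (exp (\<theta> * e v - \<theta> * s) - 1)) + (1 + p * (exp (- (\<theta> * e v) - \<theta> * s) - 1)))"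
    by (intro sum_mono add_mono bern)
  also have "\<dots> = (\<Sum>v\<in>B. 2 - 2 * p + p * exp (- (\<theta> * s)) * (exp (\<theta> * e v) + exp (- (\<theta> * e v))))"
    by (intro sum.cong refl) (simp add: exp_diff exp_minus field_simps)
  also have "\<dots> = card B * (2 - 2 * p) + p * exp (- (\<theta> * s)) * (\<Sum>v\<in>B. exp (\<theta> * e v) + exp (- (\<theta> * e v)))"
    by (subst sum.distrib) (simp flip: sum_distrib_left)
  also have "\<dots> \<le> card B * (2 - 2 * p) + p * exp (- (\<theta> * s)) * (2 * card B * exp (\<theta> * s))"
    using le p by (intro add_mono mult_left_mono) auto
  also have "\<dots> = 2 * card B" by (simp add: exp_minus field_simps)
  finally show ?thesis by (simp add: exp_minus field_simps)
qed

text \<open>The family \<open>Js\<close> is the identity in the real case, and the identity together with multiplication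
  by \<open>\<i>\<close> in the complex case, where \<open>\<complex>\<^sup>d\<close> is a real space of dimension \<open>2 d\<close> and all eigenvalues
  have even multiplicity. This is what keeps \<open>ln (2 d)\<close> from becoming \<open>ln (4 d)\<close>.\<close>

lemma eigenbasis_multiplicity:
  fixes f :: "'a::euclidean_space \<Rightarrow> 'a" and g :: "real \<Rightarrow> real"
  assumes B: "eigenbasis f B e" and sa: "\<And>x y. f x \<bullet> y = x \<bullet> f y"
    and fin: "finite Js" and lin: "\<And>J. J \<in> Js \<Longrightarrow> linear J"
    and comm: "\<And>J x. J \<in> Js \<Longrightarrow> f (J x) = J (f x)"
    and ortho: "\<And>J K x. J \<in> Js \<Longrightarrow> K \<in> Js \<Longrightarrow> norm x = 1 \<Longrightarrow> J x \<bullet> K x = (if J = K then 1 else 0)"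
    and g: "\<And>t. 0 \<le> g t" and u: "u \<in> B"
  shows "card Js * g (e u) \<le> (\<Sum>v\<in>B. g (e v))"
proof -
  have nu: "norm u = 1" and fu: "f u = e u *\<^sub>R u" using B u by (auto simp: eigenbasis_def)
  \<comment> \<open>Each \<open>J u\<close> is again an eigenvector for \<open>e u\<close>, since
    \<open>J\<close> commutes with \<open>f\<close>; hence it is orthogonal to the eigenvectors for
    other eigenvalues.\<close>
  have zero: "e v = e u" if "v \<in> B" "J \<in> Js" "J u \<bullet> v \<noteq> 0" for v J
  proof -
    have "f (J u) \<bullet> v = e u * (J u \<bullet> v)"
      using comm[OF that(2), of u] linear_cmul[OF lin[OF that(2)]] by (simp add: fu)
    moreover have "f (J u) \<bullet> v = e v * (J u \<bullet> v)"
      using B that(1) by (simp add: sa eigenbasis_def)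
    ultimately show ?thesis using that(3) by simp
  qed
  \<comment> \<open>Bessel's inequality for the orthonormal vectors \<open>J u\<close>;
    \<open>p\<close> below is the projection of \<open>v\<close> onto their span.\<close>
  have bessel: "(\<Sum>J\<in>Js. (J u \<bullet> v)\<^sup>2) \<le> 1" if "v \<in> B" for v
  proof -
    define p where "p = (\<Sum>J\<in>Js. (J u \<bullet> v) *\<^sub>R J u)"
    have vp: "p \<bullet> v = (\<Sum>J\<in>Js. (J u \<bullet> v)\<^sup>2)"
      by (simp add: p_def inner_sum_left power2_eq_square)
    have Kp: "K u \<bullet> p = K u \<bullet> v" if "K \<in> Js" for K
    proof -
      have "K u \<bullet> p = (\<Sum>J\<in>Js. (J u \<bullet> v) * (if K = J then 1 else 0))"
        unfolding p_def inner_sum_right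
        by (intro sum.cong refl) (simp add: ortho[OF that _ nu])
      also have "\<dots> = K u \<bullet> v" using fin that by (simp add: if_distrib cong: if_cong)
      finally show ?thesis .
    qed
    have "p \<bullet> p = (\<Sum>J\<in>Js. (J u \<bullet> v) * (J u \<bullet> p))"
      using inner_sum_left[of "\<lambda>J. (J u \<bullet> v) *\<^sub>R J u" Js p] by (simp flip: p_def)
    also have "\<dots> = p \<bullet> v" unfolding vp by (intro sum.cong refl) (simp add: Kp power2_eq_square)
    finally have pp: "p \<bullet> p = p \<bullet> v" .
    have "0 \<le> (v - p) \<bullet> (v - p)" by simp
    also have "\<dots> = 1 - p \<bullet> v"
      using B that unfolding inner_diff_left inner_diff_right pp inner_commute[of v p]
      by (simp add: eigenbasis_def dot_square_norm)
    finally show ?thesis using vp by simp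
  qed
  have "card Js * g (e u) = (\<Sum>J\<in>Js. \<Sum>v\<in>B. (J u \<bullet> v)\<^sup>2 * g (e u))"
  proof -
    have "(\<Sum>v\<in>B. (J u \<bullet> v)\<^sup>2) = 1" if "J \<in> Js" for J
      using eigenbasis_parseval[OF B, of "J u" "J u"] ortho[OF that that nu] by (simp add: power2_eq_square)
    then show ?thesis by (simp flip: sum_distrib_right)
  qed
  also have "\<dots> = (\<Sum>J\<in>Js. \<Sum>v\<in>B. (J u \<bullet> v)\<^sup>2 * g (e v))"
  proof (intro sum.cong refl)
    fix J v assume "J \<in> Js" "v \<in> B"
    then show "(J u \<bullet> v)\<^sup>2 * g (e u) = (J u \<bullet> v)\<^sup>2 * g (e v)"
      using zero[of v J] by (cases "J u \<bullet> v = 0") auto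
  qed
  also have "\<dots> = (\<Sum>v\<in>B. (\<Sum>J\<in>Js. (J u \<bullet> v)\<^sup>2) * g (e v))"
    by (subst sum.swap) (simp add: sum_distrib_right)
  also have "\<dots> \<le> (\<Sum>v\<in>B. 1 * g (e v))"
    using bessel g by (intro sum_mono mult_right_mono) auto
  finally show ?thesis by simp
qed

lemma eigenbasis_norm_le:
  assumes B: "eigenbasis f B e" and sa: "\<And>x y. f x \<bullet> y = x \<bullet> f y"
    and r: "0 \<le> r" "\<And>v. v \<in> B \<Longrightarrow> \<bar>e v\<bar> \<le> r"
  shows "norm (f x) \<le> r * norm x"
proof -
  have "(norm (f x))\<^sup>2 = (\<Sum>v\<in>B. (f x \<bullet> v) * (f x \<bullet> v))"
    unfolding eigenbasis_parseval[OF B] by (rule power2_norm_eq_inner)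
  also have "\<dots> = (\<Sum>v\<in>B. (e v)\<^sup>2 * ((x \<bullet> v) * (x \<bullet> v)))"
  proof (intro sum.cong refl)
    fix v assume "v \<in> B"
    then have "f x \<bullet> v = e v * (x \<bullet> v)" unfolding sa using B by (simp add: eigenbasis_def)
    then show "(f x \<bullet> v) * (f x \<bullet> v) = (e v)\<^sup>2 * ((x \<bullet> v) * (x \<bullet> v))"
      by (simp add: power2_eq_square)
  qed
  also have "\<dots> \<le> (\<Sum>v\<in>B. r\<^sup>2 * ((x \<bullet> v) * (x \<bullet> v)))"
  proof (intro sum_mono mult_right_mono)
    fix v assume "v \<in> B"
    then show "(e v)\<^sup>2 \<le> r\<^sup>2" using r(2)[of v] r(1) by (simp add: abs_le_square_iff[symmetric])
  qed simp
  also have "\<dots> = r\<^sup>2 * (x \<bullet> x)"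
    unfolding sum_distrib_left[symmetric] eigenbasis_parseval[OF B] ..
  also have "\<dots> = (r * norm x)\<^sup>2" by (simp add: power_mult_distrib dot_square_norm)
  finally show ?thesis by (rule power2_le_imp_le) (simp add: r(1))
qed

lemma sum_inverse_sqrt_le: "(\<Sum>j=1..k. 1 / sqrt (real j)) \<le> 2 * sqrt (real k)"
proof (induction k)
  case (Suc k)
  define a b where "a = sqrt (real k)" and "b = sqrt (real (Suc k))"
  have ab: "0 \<le> a" "0 < b" "a\<^sup>2 + 1 = b\<^sup>2" by (auto simp: a_def b_def)
  have "2 * a * b + 1 \<le> 2 * b\<^sup>2" using ab(3) zero_le_power2[of "a - b"] by (simp add: power2_diff)
  then have "2 * a + 1 / b \<le> 2 * b" using ab(2) by (simp add: field_simps power2_eq_square)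
  then show ?case using Suc by (simp add: a_def b_def)
qed simp


section \<open>Greedy choice of the indices\<close>

text \<open>Stated for operators on a real Euclidean space in order to treat real symmetric and
  complex Hermitian matrices together, the latter acting on the underlying real space.\<close>

locale psd_resolution =
  fixes I :: "nat set" and lam :: "nat \<Rightarrow> real" and M :: real
    and A :: "nat \<Rightarrow> 'a::euclidean_space \<Rightarrow> 'a"
  assumes fin: "finite I" and lam_nonneg: "\<And>i. i \<in> I \<Longrightarrow> 0 \<le> lam i"
    and lam_sum: "(\<Sum>i\<in>I. lam i) = 1"
    and lin: "\<And>i. i \<in> I \<Longrightarrow> linear (A i)"
    and sa: "\<And>i x y. i \<in> I \<Longrightarrow> A i x \<bullet> y = x \<bullet> A i y"
    and psd: "\<And>i x. i \<in> I \<Longrightarrow> 0 \<le> x \<bullet> A i x"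
    and bound: "\<And>i x. i \<in> I \<Longrightarrow> norm (A i x) \<le> M * norm x"
    and resolution: "\<And>x. (\<Sum>i\<in>I. lam i *\<^sub>R A i x) = x"
begin

lemma weighted_quadratic_form: "(\<Sum>i\<in>I. lam i * (x \<bullet> A i x)) = x \<bullet> x"
  using arg_cong[OF resolution[of x], of "inner x"] by (simp add: inner_sum_right)

text \<open>On a unit vector the quadratic forms of the \<open>A i\<close> are at most
  \<open>M\<close>, and their weighted mean is 1.\<close>

lemma M_ge_1: "1 \<le> M"
proof -
  obtain b :: 'a where b: "norm b = 1" using norm_Basis nonempty_Basis by blast
  have "1 = (\<Sum>i\<in>I. lam i * (b \<bullet> A i b))" using weighted_quadratic_form[of b] b by (simp add: dot_square_norm)
  also have "\<dots> \<le> (\<Sum>i\<in>I. lam i * M)"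
  proof (intro sum_mono mult_left_mono lam_nonneg)
    fix i assume i: "i \<in> I"
    have "b \<bullet> A i b \<le> norm b * norm (A i b)" by (rule norm_cauchy_schwarz)
    also have "\<dots> \<le> M" using bound[OF i, of b] b by simp
    finally show "b \<bullet> A i b \<le> M" .
  qed
  also have "\<dots> = M" using lam_sum by (simp flip: sum_distrib_right)
  finally show ?thesis .
qed

text \<open>This is A^2 \<le> M A. Positivity is tested at \<open>M *\<^sub>R x - A i x\<close>, and
  the cubic term of the expansion is at most \<open>M\<close> times the squared norm of
  \<open>A i x\<close>.\<close>

lemma norm_square_le_quadratic_form:
  assumes i: "i \<in> I"
  shows "A i x \<bullet> A i x \<le> M * (x \<bullet> A i x)"
proof -
  define n where "n = A i x \<bullet> A i x"
  have M: "0 < M" using M_ge_1 by simp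
  have "A i x \<bullet> A i (A i x) \<le> norm (A i x) * norm (A i (A i x))" by (rule norm_cauchy_schwarz)
  also have "\<dots> \<le> norm (A i x) * (M * norm (A i x))" by (intro mult_left_mono bound i) simp
  also have "\<dots> = M * n" by (simp add: n_def dot_square_norm power2_eq_square)
  finally have h: "A i x \<bullet> A i (A i x) \<le> M * n" .
  have "0 \<le> (M *\<^sub>R x - A i x) \<bullet> A i (M *\<^sub>R x - A i x)" by (rule psd[OF i])
  also have "\<dots> = M * (M * (x \<bullet> A i x)) - 2 * (M * n) + A i x \<bullet> A i (A i x)"
    unfolding linear_diff[OF lin[OF i]] linear_cmul[OF lin[OF i]]
    by (simp add: inner_diff_left inner_diff_right sa[OF i, of x "A i x", symmetric] n_def right_diff_distrib)
  finally have "M * n \<le> M * (M * (x \<bullet> A i x))" using h by simp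
  then show ?thesis using M by (simp add: n_def)
qed

text \<open>Averaging over \<open>i\<close> replaces \<open>A i\<close> by the identity. The trace
  of the positive exponential then gains the factor \<open>1 + (1 + z) * \<theta>\<close>, that of
  the negative one \<open>1 - (1 - z) * \<theta>\<close>; with \<open>1 + t \<le> exp t\<close> and
  the shift by the identity removed, both factors become \<open>exp (\<theta> * z)\<close>. Some
  index does at least as well as the mean.\<close>

lemma greedy_step:
  assumes T: "linear T" "\<And>x y. T x \<bullet> y = x \<bullet> T y" and B: "eigenbasis T B e"
    and th: "0 < \<theta>" "\<theta> * M \<le> 1"
  shows "\<exists>i\<in>I. \<exists>C c. eigenbasis (\<lambda>x. T x + A i x - x) C c \<and>
    (\<Sum>w\<in>C. exp (\<theta> * c w) + exp (- (\<theta> * c w)))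
      \<le> exp (\<theta> * (\<theta> * M)) * (\<Sum>v\<in>B. exp (\<theta> * e v) + exp (- (\<theta> * e v)))"
proof -
  define z where "z = \<theta> * M"
  have z: "0 \<le> z" "z \<le> 1" using th M_ge_1 by (auto simp: z_def)
  define Sp where "Sp = (\<Sum>v\<in>B. exp (\<theta> * e v))"
  define Sm where "Sm = (\<Sum>v\<in>B. exp (- (\<theta> * e v)))"
  have "\<forall>i\<in>I. \<exists>C c. eigenbasis (\<lambda>x. T x + A i x - x) C c"
  proof
    fix i assume i: "i \<in> I"
    have l: "linear (\<lambda>x. T x + A i x - x)"
      using T(1) lin[OF i] by (intro linear_compose_add linear_compose_sub linear_ident)
    have s: "(T x + A i x - x) \<bullet> y = x \<bullet> (T y + A i y - y)" for x y
      by (simp add: inner_diff_left inner_diff_right inner_add_left inner_add_right T(2) sa[OF i])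
    show "\<exists>C c. eigenbasis (\<lambda>x. T x + A i x - x) C c" by (rule exists_eigenbasis[OF l s]) blast
  qed
  then obtain C c where C: "\<And>i. i \<in> I \<Longrightarrow> eigenbasis (\<lambda>x. T x + A i x - x) (C i) (c i)"
    unfolding bchoice_iff by blast
  define Up where "Up i = (\<Sum>w\<in>C i. exp (\<theta> * c i w))" for i
  define Dn where "Dn i = (\<Sum>w\<in>C i. exp (- (\<theta> * c i w)))" for i
  \<comment> \<open>The identity only shifts eigenvalues by 1. It is set aside because the trace
    inequality is applied to the difference \<open>\<theta> *\<^sub>R A i x\<close>, which satisfies
    D^2 \<le> z D.\<close>
  have C1: "eigenbasis (\<lambda>x. T x + A i x) (C i) (\<lambda>w. c i w + 1)" if "i \<in> I" for i
    using C[OF that] by (auto simp: eigenbasis_def algebra_simps)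
  have up: "exp \<theta> * Up i \<le> (\<Sum>v\<in>B. exp (\<theta> * e v) * (1 + (1 + z) * (\<theta> * (v \<bullet> A i v))))" if i: "i \<in> I" for i
  proof -
    have "(\<Sum>w\<in>C i. exp (\<theta> * (c i w + 1))) \<le> (\<Sum>v\<in>B. exp (\<theta> * e v) * (1 + (1 + z) * (v \<bullet> (\<theta> *\<^sub>R A i v))))"
    proof (rule eigenbasis_sum_exp_le[where P = "\<lambda>x. \<theta> *\<^sub>R T x" and Q = "\<lambda>x. \<theta> *\<^sub>R (T x + A i x)"])
      show "eigenbasis (\<lambda>x. \<theta> *\<^sub>R T x) B (\<lambda>v. \<theta> * e v)" by (rule eigenbasis_scaleR[OF B])
      show "eigenbasis (\<lambda>x. \<theta> *\<^sub>R (T x + A i x)) (C i) (\<lambda>w. \<theta> * (c i w + 1))" by (rule eigenbasis_scaleR[OF C1[OF i]])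
      show "(\<theta> *\<^sub>R A i x) \<bullet> (\<theta> *\<^sub>R A i x) \<le> z * (x \<bullet> (\<theta> *\<^sub>R A i x))" for x
        using mult_left_mono[OF norm_square_le_quadratic_form[OF i, of x], of "\<theta> * \<theta>"] th
        by (simp add: z_def mult_ac)
    qed (use z in \<open>auto simp: T(2) sa[OF i] inner_add_left inner_add_right scaleR_add_right\<close>)
    then show ?thesis by (simp add: Up_def distrib_left exp_add sum_distrib_left mult_ac)
  qed
  have dn: "exp (- \<theta>) * Dn i \<le> (\<Sum>v\<in>B. exp (- (\<theta> * e v)) * (1 + (z - 1) * (\<theta> * (v \<bullet> A i v))))" if i: "i \<in> I" for i
  proof -
    \<comment> \<open>Here the difference is \<open>- (\<theta> *\<^sub>R A i v)\<close>, so the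
      trace inequality is used with \<open>- z\<close>.\<close>
    have "(\<Sum>w\<in>C i. exp (- (\<theta> * (c i w + 1)))) \<le> (\<Sum>v\<in>B. exp (- (\<theta> * e v)) * (1 + (1 + - z) * (v \<bullet> (- (\<theta> *\<^sub>R A i v)))))"
    proof (rule eigenbasis_sum_exp_le[where P = "\<lambda>x. - (\<theta> *\<^sub>R T x)" and Q = "\<lambda>x. - (\<theta> *\<^sub>R (T x + A i x))"])
      show "eigenbasis (\<lambda>x. - (\<theta> *\<^sub>R T x)) B (\<lambda>v. - (\<theta> * e v))"
        by (rule eigenbasis_uminus[OF eigenbasis_scaleR[OF B]])
      show "eigenbasis (\<lambda>x. - (\<theta> *\<^sub>R (T x + A i x))) (C i) (\<lambda>w. - (\<theta> * (c i w + 1)))"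
        by (rule eigenbasis_uminus[OF eigenbasis_scaleR[OF C1[OF i]]])
      show "(- (\<theta> *\<^sub>R A i x)) \<bullet> (- (\<theta> *\<^sub>R A i x)) \<le> - z * (x \<bullet> (- (\<theta> *\<^sub>R A i x)))" for x
        using mult_left_mono[OF norm_square_le_quadratic_form[OF i, of x], of "\<theta> * \<theta>"] th
        by (simp add: z_def mult_ac)
    qed (use z in \<open>auto simp: T(2) sa[OF i] inner_diff_left inner_diff_right inner_add_left inner_add_right scaleR_add_right\<close>)
    moreover have "exp (- \<theta>) * Dn i = (\<Sum>w\<in>C i. exp (- (\<theta> * (c i w + 1))))"
      unfolding Dn_def sum_distrib_left exp_add[symmetric]
      by (intro sum.cong refl arg_cong[where f = exp]) (simp add: algebra_simps)
    moreover have "1 + (1 + - z) * (v \<bullet> (- (\<theta> *\<^sub>R A i v))) = 1 + (z - 1) * (\<theta> * (v \<bullet> A i v))" for v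
      by (simp add: algebra_simps)
    ultimately show ?thesis by (simp only:)
  qed
  have nB: "v \<bullet> v = 1" if "v \<in> B" for v using B that by (simp add: eigenbasis_def dot_square_norm)
  have average: "(\<Sum>i\<in>I. lam i * (\<Sum>v\<in>B. h v * (1 + t * (\<theta> * (v \<bullet> A i v))))) = (1 + t * \<theta>) * (\<Sum>v\<in>B. h v)" for h t
  proof -
    have "(\<Sum>i\<in>I. lam i * (\<Sum>v\<in>B. h v * (1 + t * (\<theta> * (v \<bullet> A i v)))))
        = (\<Sum>v\<in>B. \<Sum>i\<in>I. lam i * (h v * (1 + t * (\<theta> * (v \<bullet> A i v)))))"
      unfolding sum_distrib_left by (rule sum.swap)
    also have "\<dots> = (\<Sum>v\<in>B. h v * ((\<Sum>i\<in>I. lam i) + t * \<theta> * (\<Sum>i\<in>I. lam i * (v \<bullet> A i v))))"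
      by (simp add: sum_distrib_left distrib_left sum.distrib mult_ac)
    also have "\<dots> = (\<Sum>v\<in>B. h v * (1 + t * \<theta>))"
      by (intro sum.cong refl) (simp add: lam_sum weighted_quadratic_form nB)
    finally show ?thesis by (simp only: sum_distrib_right mult.commute[of "1 + t * \<theta>"])
  qed
  have "exp \<theta> * (\<Sum>i\<in>I. lam i * Up i) = (\<Sum>i\<in>I. lam i * (exp \<theta> * Up i))"
    by (simp add: sum_distrib_left mult_ac)
  also have "\<dots> \<le> (1 + (1 + z) * \<theta>) * Sp"
    unfolding Sp_def average[symmetric] by (intro sum_mono mult_left_mono up lam_nonneg)
  also have "\<dots> \<le> exp ((1 + z) * \<theta>) * Sp"
    by (intro mult_right_mono exp_ge_add_one_self) (simp add: Sp_def sum_nonneg)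
  finally have U: "(\<Sum>i\<in>I. lam i * Up i) \<le> exp (\<theta> * z) * Sp"
    by (simp add: ring_distribs exp_add mult.commute[of z] mult.assoc)
  have "exp (- \<theta>) * (\<Sum>i\<in>I. lam i * Dn i) = (\<Sum>i\<in>I. lam i * (exp (- \<theta>) * Dn i))"
    by (simp add: sum_distrib_left mult_ac)
  also have "\<dots> \<le> (1 + (z - 1) * \<theta>) * Sm"
    unfolding Sm_def average[symmetric] by (intro sum_mono mult_left_mono dn lam_nonneg)
  also have "\<dots> \<le> exp ((z - 1) * \<theta>) * Sm"
    by (intro mult_right_mono exp_ge_add_one_self) (simp add: Sm_def sum_nonneg)
  also have "exp ((z - 1) * \<theta>) * Sm = exp (- \<theta>) * (exp (\<theta> * z) * Sm)"
    by (simp add: left_diff_distrib mult.commute[of z] flip: mult.assoc exp_add)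
  finally have D: "(\<Sum>i\<in>I. lam i * Dn i) \<le> exp (\<theta> * z) * Sm"
    by simp
  show ?thesis
  proof (rule ccontr)
    assume "\<not> ?thesis"
    then have gt: "exp (\<theta> * z) * (Sp + Sm) < Up i + Dn i" if "i \<in> I" for i
      using C[OF that] that by (force simp: z_def Sp_def Sm_def Up_def Dn_def sum.distrib not_le)
    \<comment> \<open>An index of positive weight makes the comparison of weighted sums
      strict.\<close>
    obtain j where j: "j \<in> I" "lam j \<noteq> 0" using lam_sum by (metis sum.neutral zero_neq_one)
    have "exp (\<theta> * z) * (Sp + Sm) = (\<Sum>i\<in>I. lam i * (exp (\<theta> * z) * (Sp + Sm)))"
      using lam_sum by (simp flip: sum_distrib_right)
    also have "\<dots> < (\<Sum>i\<in>I. lam i * (Up i + Dn i))"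
    proof (rule sum_strict_mono_ex1)
      show "\<exists>i\<in>I. lam i * (exp (\<theta> * z) * (Sp + Sm)) < lam i * (Up i + Dn i)"
        using j gt[OF j(1)] lam_nonneg[OF j(1)] by (intro bexI[of _ j]) auto
    qed (use fin gt lam_nonneg in \<open>auto intro: mult_left_mono simp: less_imp_le\<close>)
    also have "\<dots> \<le> exp (\<theta> * z) * (Sp + Sm)"
      using U D by (simp add: distrib_left sum.distrib)
    finally show False by simp
  qed
qed

end

section \<open>Step sizes and their sum\<close>

definition step_scale :: "real \<Rightarrow> nat \<Rightarrow> real" where
  "step_scale n j = (if real j \<le> n then 1 else sqrt (n / real j))"

lemma step_scale_pos: "0 < n \<Longrightarrow> 0 < step_scale n j"
  by (auto simp: step_scale_def)

lemma step_scale_le_1: "0 < n \<Longrightarrow> step_scale n j \<le> 1"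
  by (auto simp: step_scale_def)

lemma step_scale_Suc_le: "0 < n \<Longrightarrow> step_scale n (Suc j) \<le> step_scale n j"
  by (auto simp: step_scale_def frac_le)

text \<open>For \<open>n = M ln (2 d)\<close> the step sizes are the
  \<open>M \<theta>\<^sub>j\<close>, and this gives the constants 2 and 3. If
  \<open>k \<le> n\<close>, the sum is \<open>k \<le> n\<close> and the second term is
  \<open>n\<close>. If \<open>k > n\<close>, they contribute at most \<open>2 sqrt (n k)\<close> and
  exactly \<open>sqrt (n k)\<close>.\<close>

lemma sum_step_scale_bound:
  assumes n: "0 < n" and k: "1 \<le> k"
  shows "(\<Sum>j=1..k. step_scale n j) + n / step_scale n k \<le>
    real k * (if real k \<le> n then 2 * (n / real k) else 3 * sqrt (n / real k))"
proof (cases "real k \<le> n")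
  case True
  have "(\<Sum>j=1..k. step_scale n j) \<le> (\<Sum>j=1..k. 1)" by (intro sum_mono step_scale_le_1 n)
  then show ?thesis using True k by (simp add: step_scale_def)
next
  case False
  have "step_scale n j \<le> sqrt n * (1 / sqrt (real j))" if "1 \<le> j" for j
    using that n by (auto simp: step_scale_def real_sqrt_divide)
  then have "(\<Sum>j=1..k. step_scale n j) \<le> (\<Sum>j=1..k. sqrt n * (1 / sqrt (real j)))"
    by (intro sum_mono) auto
  also have "\<dots> \<le> sqrt n * (2 * sqrt (real k))"
    unfolding sum_distrib_left[symmetric] using sum_inverse_sqrt_le n by (intro mult_left_mono) auto
  finally have "(\<Sum>j=1..k. step_scale n j) \<le> 2 * (sqrt n * sqrt (real k))" by simp
  moreover have "n / step_scale n k = sqrt n * sqrt (real k)"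
    using False n by (simp add: step_scale_def real_sqrt_divide real_div_sqrt flip: times_divide_eq_left)
  moreover have "real k * sqrt (n / real k) = sqrt n * sqrt (real k)"
    using n k by (simp add: real_sqrt_divide field_simps)
  ultimately show ?thesis using False by simp
qed

section \<open>The invariant of the greedy construction and the norm bound\<close>

context psd_resolution
begin

text \<open>The trace of exp(\<theta> T) + exp(- \<theta> T), normalized by its value
  \<open>2 * DIM('a)\<close> at \<open>T = 0\<close>, is at most \<open>exp (\<theta> * s)\<close>.
  The budget \<open>s\<close> has the scale of an eigenvalue, so it can be kept when
  \<open>\<theta>\<close> changes.\<close>

definition controlled :: "('a \<Rightarrow> 'a) \<Rightarrow> real \<Rightarrow> real \<Rightarrow> bool" where
  "controlled T \<theta> s \<longleftrightarrow> linear T \<and> (\<forall>x y. T x \<bullet> y = x \<bullet> T y) \<and>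
     (\<exists>B e. eigenbasis T B e \<and>
       (\<Sum>v\<in>B. exp (\<theta> * e v) + exp (- (\<theta> * e v))) \<le> 2 * DIM('a) * exp (\<theta> * s))"

lemma controlled_0: "controlled (\<lambda>x. 0) \<theta> 0"
proof -
  obtain B e where B: "eigenbasis (\<lambda>x::'a. 0) B e"
    using exists_eigenbasis[of "\<lambda>x::'a. 0"] module_hom_zero by auto
  have "e v = 0" if "v \<in> B" for v using B that by (auto simp: eigenbasis_def)
  then have "(\<Sum>v\<in>B. exp (\<theta> * e v) + exp (- (\<theta> * e v))) \<le> 2 * DIM('a) * exp (\<theta> * 0)"
    using eigenbasis_card[OF B] by simp
  then show ?thesis using B unfolding controlled_def by (auto simp: module_hom_zero)
qed

text \<open>First the scale is lowered to \<open>\<theta>'\<close> at no cost in \<open>s\<close>;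
  then the greedy step at the new scale adds \<open>\<theta>' * M\<close>.\<close>

lemma controlled_step:
  assumes T: "controlled T \<theta> s" and th: "0 < \<theta>'" "\<theta>' \<le> \<theta>" "\<theta>' * M \<le> 1"
  shows "\<exists>i\<in>I. controlled (\<lambda>x. T x + A i x - x) \<theta>' (s + \<theta>' * M)"
proof -
  obtain B e where B: "eigenbasis T B e"
    and le: "(\<Sum>v\<in>B. exp (\<theta> * e v) + exp (- (\<theta> * e v))) \<le> 2 * DIM('a) * exp (\<theta> * s)"
    and lT: "linear T" and sT: "\<And>x y. T x \<bullet> y = x \<bullet> T y"
    using T unfolding controlled_def by blast
  have "finite B" using B by (simp add: eigenbasis_def)
  then have le': "(\<Sum>v\<in>B. exp (\<theta>' * e v) + exp (- (\<theta>' * e v))) \<le> 2 * DIM('a) * exp (\<theta>' * s)"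
    using sum_exp_smaller_scale[of B \<theta>' \<theta> e s] th le eigenbasis_card[OF B] by simp
  obtain i C c where i: "i \<in> I" and C: "eigenbasis (\<lambda>x. T x + A i x - x) C c"
    and leC: "(\<Sum>w\<in>C. exp (\<theta>' * c w) + exp (- (\<theta>' * c w)))
      \<le> exp (\<theta>' * (\<theta>' * M)) * (\<Sum>v\<in>B. exp (\<theta>' * e v) + exp (- (\<theta>' * e v)))"
    using greedy_step[OF lT sT B th(1,3)] by blast
  note leC
  also have "exp (\<theta>' * (\<theta>' * M)) * (\<Sum>v\<in>B. exp (\<theta>' * e v) + exp (- (\<theta>' * e v)))
      \<le> exp (\<theta>' * (\<theta>' * M)) * (2 * DIM('a) * exp (\<theta>' * s))"
    by (intro mult_left_mono le') simp
  also have "\<dots> = 2 * DIM('a) * exp (\<theta>' * (s + \<theta>' * M))"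
    by (simp add: distrib_left exp_add)
  finally have "(\<Sum>w\<in>C. exp (\<theta>' * c w) + exp (- (\<theta>' * c w))) \<le> 2 * DIM('a) * exp (\<theta>' * (s + \<theta>' * M))" .
  moreover have "linear (\<lambda>x. T x + A i x - x)"
    using lT lin[OF i] by (intro linear_compose_add linear_compose_sub linear_ident)
  moreover have "(T x + A i x - x) \<bullet> y = x \<bullet> (T y + A i y - y)" for x y
    by (simp add: inner_diff_left inner_diff_right inner_add_left inner_add_right sT sa[OF i])
  ultimately show ?thesis using i C unfolding controlled_def by blast
qed

text \<open>Each eigenvalue has multiplicity at least \<open>card Js\<close>, so its exponential is
  counted that often in the trace. Since the dimension is \<open>card Js * d\<close>, the factor
  \<open>card Js\<close> cancels and only \<open>2 * d\<close> enters the logarithm.\<close>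

lemma controlled_norm_le:
  assumes T: "controlled T \<theta> s" and th: "0 < \<theta>" and s: "0 \<le> s"
    and Js: "finite Js" "\<And>J. J \<in> Js \<Longrightarrow> linear J"
    and comm: "\<And>J x. J \<in> Js \<Longrightarrow> T (J x) = J (T x)"
    and ortho: "\<And>J K x. J \<in> Js \<Longrightarrow> K \<in> Js \<Longrightarrow> norm x = 1 \<Longrightarrow> J x \<bullet> K x = (if J = K then 1 else 0)"
    and d: "DIM('a) = card Js * d"
  shows "norm (T x) \<le> (s + ln (2 * real d) / \<theta>) * norm x"
proof -
  obtain B e where B: "eigenbasis T B e"
    and le: "(\<Sum>v\<in>B. exp (\<theta> * e v) + exp (- (\<theta> * e v))) \<le> 2 * DIM('a) * exp (\<theta> * s)"
    and sT: "\<And>x y. T x \<bullet> y = x \<bullet> T y"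
    using T unfolding controlled_def by blast
  have d0: "0 < d" "0 < card Js" using d DIM_positive[where 'a='a] by (auto intro: gr0I)
  have bound: "t \<le> s + ln (2 * real d) / \<theta>" if t: "card Js * exp (\<theta> * t) \<le> (\<Sum>v\<in>B. exp (\<theta> * e v) + exp (- (\<theta> * e v)))" for t
  proof -
    have "card Js * exp (\<theta> * t) \<le> card Js * (2 * real d * exp (\<theta> * s))"
      using order_trans[OF t le] d by (simp add: mult_ac)
    then have "exp (\<theta> * t) \<le> 2 * real d * exp (\<theta> * s)" using d0 by simp
    also have "\<dots> = exp (ln (2 * real d) + \<theta> * s)" using d0 by (simp add: exp_add)
    finally show ?thesis using th by (simp add: field_simps)
  qed
  have "\<bar>e v\<bar> \<le> s + ln (2 * real d) / \<theta>" if v: "v \<in> B" for v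
  proof -
    have mult: "card Js * g (e v) \<le> (\<Sum>v\<in>B. g (e v))" if "\<And>t. 0 \<le> g t" for g :: "real \<Rightarrow> real"
      by (rule eigenbasis_multiplicity[OF B sT Js(1)]) (fact Js(2) comm ortho that v)+
    have "card Js * exp (\<theta> * e v) \<le> (\<Sum>v\<in>B. exp (\<theta> * e v))"
      using mult[of "\<lambda>t. exp (\<theta> * t)"] by simp
    also have "\<dots> \<le> (\<Sum>v\<in>B. exp (\<theta> * e v) + exp (- (\<theta> * e v)))" by (intro sum_mono) simp
    finally have "e v \<le> s + ln (2 * real d) / \<theta>" by (rule bound)
    moreover have "card Js * exp (\<theta> * - e v) \<le> (\<Sum>v\<in>B. exp (\<theta> * - e v))"
      using mult[of "\<lambda>t. exp (\<theta> * - t)"] by simp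
    then have "card Js * exp (\<theta> * - e v) \<le> (\<Sum>v\<in>B. exp (\<theta> * e v) + exp (- (\<theta> * e v)))"
      by (rule order_trans) (intro sum_mono, simp)
    then have "- e v \<le> s + ln (2 * real d) / \<theta>" by (rule bound)
    ultimately show ?thesis by simp
  qed
  moreover have "0 \<le> s + ln (2 * real d) / \<theta>" using d0 th s by simp
  ultimately show ?thesis by (intro eigenbasis_norm_le[OF B sT])
qed

lemma exists_approximating_sequence:
  assumes Js: "finite Js" "\<And>J. J \<in> Js \<Longrightarrow> linear J"
    and comm: "\<And>i J x. i \<in> I \<Longrightarrow> J \<in> Js \<Longrightarrow> A i (J x) = J (A i x)"
    and ortho: "\<And>J K x. J \<in> Js \<Longrightarrow> K \<in> Js \<Longrightarrow> norm x = 1 \<Longrightarrow> J x \<bullet> K x = (if J = K then 1 else 0)"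
    and d: "DIM('a) = card Js * d"
  obtains idx where "\<And>r. 1 \<le> r \<Longrightarrow> idx r \<in> I"
    and "\<And>k x. 1 \<le> k \<Longrightarrow> norm ((1 / real k) *\<^sub>R (\<Sum>r=1..k. A (idx r) x) - x) \<le>
      (if real k \<le> M * ln (2 * real d) then 2 * (M * ln (2 * real d) / real k)
       else 3 * sqrt (M * ln (2 * real d) / real k)) * norm x"
proof -
  define n where "n = M * ln (2 * real d)"
  have M: "0 < M" using M_ge_1 by simp
  have "0 < d" using d DIM_positive[where 'a='a] by (auto intro: gr0I)
  then have n: "0 < n" using M by (simp add: n_def)
  define \<theta> where "\<theta> k = step_scale n k / M" for k
  define s where "s k = (\<Sum>j=1..k. step_scale n j)" for k
  have th: "0 < \<theta> k" "\<theta> (Suc k) \<le> \<theta> k" "\<theta> k * M = step_scale n k" for k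
    using M step_scale_pos[OF n] step_scale_Suc_le[OF n] by (auto simp: \<theta>_def divide_right_mono)
  \<comment> \<open>A state pairs the operator after \<open>k\<close> steps with the index chosen
    last. State 0 is the zero operator with an arbitrary second component, so indices are meaningful
    from 1 on.\<close>
  have "\<exists>f. \<forall>k. (controlled (fst (f k)) (\<theta> k) (s k) \<and> (k \<noteq> 0 \<longrightarrow> snd (f k) \<in> I)) \<and>
      fst (f (Suc k)) = (\<lambda>x. fst (f k) x + A (snd (f (Suc k))) x - x) \<and> (k = 0 \<longrightarrow> fst (f k) = (\<lambda>x. 0))"
  proof (rule dependent_nat_choice[where P = "\<lambda>k f. (controlled (fst f) (\<theta> k) (s k) \<and> (k \<noteq> 0 \<longrightarrow> snd f \<in> I)) \<and> (k = 0 \<longrightarrow> fst f = (\<lambda>x. 0))"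
      and Q = "\<lambda>k f g. fst g = (\<lambda>x. fst f x + A (snd g) x - x)", THEN ex_forward])
    show "\<exists>f. (controlled (fst f) (\<theta> 0) (s 0) \<and> (0 \<noteq> (0::nat) \<longrightarrow> snd f \<in> I)) \<and> (0 = (0::nat) \<longrightarrow> fst f = (\<lambda>x. 0))"
      using controlled_0 by (intro exI[of _ "(\<lambda>x. 0, undefined)"]) (simp add: s_def)
  next
    fix f :: "('a \<Rightarrow> 'a) \<times> nat" and k
    assume "(controlled (fst f) (\<theta> k) (s k) \<and> (k \<noteq> 0 \<longrightarrow> snd f \<in> I)) \<and> (k = 0 \<longrightarrow> fst f = (\<lambda>x. 0))"
    then obtain i where "i \<in> I" "controlled (\<lambda>x. fst f x + A i x - x) (\<theta> (Suc k)) (s k + \<theta> (Suc k) * M)"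
      using controlled_step[of "fst f" "\<theta> k" "s k" "\<theta> (Suc k)"] th step_scale_le_1[OF n] by metis
    then show "\<exists>g. ((controlled (fst g) (\<theta> (Suc k)) (s (Suc k)) \<and> (Suc k \<noteq> 0 \<longrightarrow> snd g \<in> I)) \<and> (Suc k = 0 \<longrightarrow> fst g = (\<lambda>x. 0))) \<and>
        fst g = (\<lambda>x. fst f x + A (snd g) x - x)"
      by (intro exI[of _ "(\<lambda>x. fst f x + A i x - x, i)"]) (simp add: s_def th(3))
  qed auto
  then obtain f where f: "\<And>k. controlled (fst (f k)) (\<theta> k) (s k)" "\<And>k. k \<noteq> 0 \<Longrightarrow> snd (f k) \<in> I"
    "\<And>k. fst (f (Suc k)) = (\<lambda>x. fst (f k) x + A (snd (f (Suc k))) x - x)" "fst (f 0) = (\<lambda>x. 0)"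
    by blast
  define idx where "idx r = snd (f r)" for r
  have idx: "idx r \<in> I" if "1 \<le> r" for r using f(2)[of r] that by (simp add: idx_def)
  have T: "fst (f k) x = (\<Sum>r=1..k. A (idx r) x) - real k *\<^sub>R x" for k x
    by (induction k) (simp_all add: f(3,4) idx_def algebra_simps)
  have "norm ((1 / real k) *\<^sub>R (\<Sum>r=1..k. A (idx r) x) - x) \<le>
      (if real k \<le> n then 2 * (n / real k) else 3 * sqrt (n / real k)) * norm x" (is "_ \<le> ?b * _")
    if k: "1 \<le> k" for k x
  proof -
    have "(1 / real k) *\<^sub>R (\<Sum>r=1..k. A (idx r) x) - x = (1 / real k) *\<^sub>R fst (f k) x"
      using k by (simp add: T scaleR_diff_right)
    then have "norm ((1 / real k) *\<^sub>R (\<Sum>r=1..k. A (idx r) x) - x) = norm (fst (f k) x) / real k" by simp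
    also have "norm (fst (f k) x) \<le> (s k + ln (2 * real d) / \<theta> k) * norm x"
    proof (rule controlled_norm_le[OF f(1) th(1) _ Js _ ortho d])
      show "0 \<le> s k" unfolding s_def using step_scale_pos[OF n] by (intro sum_nonneg less_imp_le)
      show "fst (f k) (J x) = J (fst (f k) x)" if J: "J \<in> Js" for J x
        using idx comm[OF _ J] by (simp add: T linear_diff linear_sum linear_cmul Js(2)[OF J])
    qed
    also have "s k + ln (2 * real d) / \<theta> k = (\<Sum>j=1..k. step_scale n j) + n / step_scale n k"
      by (simp add: s_def \<theta>_def n_def)
    also have "\<dots> \<le> real k * ?b" by (rule sum_step_scale_bound[OF n k])
    finally show ?thesis using k by (simp add: divide_right_mono mult_right_mono)
  qed
  then show ?thesis using that[of idx] idx unfolding n_def by blast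
qed

end

section \<open>Real and complex matrices\<close>

lemma scaleR_matrix_vector_mult:
  fixes A :: "'a::real_algebra_1^'n^'m"
  shows "(c *\<^sub>R A) *v x = c *\<^sub>R (A *v x)"
  by (simp add: matrix_vector_mult_def vec_eq_iff scaleR_sum_right)

lemma sum_matrix_vector_mult:
  fixes A :: "'i \<Rightarrow> 'a::real_algebra_1^'n^'m"
  shows "(\<Sum>i\<in>S. A i) *v x = (\<Sum>i\<in>S. A i *v x)"
  by (induction S rule: infinite_finite_induct) (simp_all add: matrix_vector_mult_add_rdistrib)

lemma norm_matrix_vector_le_opnorm:
  fixes A :: "'a::{real_normed_field,euclidean_space}^'d^'d"
  shows "norm (A *v x) \<le> opnorm A * norm x"
  unfolding opnorm_def by (rule onorm) (simp add: linear_conv_bounded_linear[symmetric])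

text \<open>Common to both scalar fields: \<open>Js\<close> has one map for each real dimension of
  the field, so the real dimension of the space is \<open>card Js * CARD('d)\<close> and the matrix
  size enters the logarithm.\<close>

lemma exists_matrix_approximating_sequence:
  fixes A :: "nat \<Rightarrow> 'a::{real_normed_field,euclidean_space}^'d^'d"
  assumes I: "finite I" "\<forall>i\<in>I. lam i \<ge> 0" "(\<Sum>i\<in>I. lam i) = 1"
    and sa: "\<And>i x y. i \<in> I \<Longrightarrow> (A i *v x) \<bullet> y = x \<bullet> (A i *v y)"
    and psd: "\<And>i x. i \<in> I \<Longrightarrow> 0 \<le> x \<bullet> (A i *v x)"
    and M: "\<forall>i\<in>I. opnorm (A i) \<le> M"
    and res: "(\<Sum>i\<in>I. lam i *\<^sub>R A i) = mat 1"
    and Js: "finite Js" "\<And>J. J \<in> Js \<Longrightarrow> linear J"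
    and comm: "\<And>i J x. i \<in> I \<Longrightarrow> J \<in> Js \<Longrightarrow> A i *v J x = J (A i *v x)"
    and ortho: "\<And>J K x. J \<in> Js \<Longrightarrow> K \<in> Js \<Longrightarrow> norm x = 1 \<Longrightarrow> J x \<bullet> K x = (if J = K then 1 else 0)"
    and d: "DIM('a) = card Js"
  shows "\<exists>idx. (\<forall>r\<ge>1. idx r \<in> I) \<and>
           (\<forall>k\<ge>1.
              opnorm ((1 / real k) *\<^sub>R (\<Sum>r=1..k. A (idx r)) - mat 1) \<le>
                (if real k \<le> M * ln (2 * real CARD('d))
                 then 2 * (M * ln (2 * real CARD('d)) / real k)
                 else 3 * sqrt (M * ln (2 * real CARD('d)) / real k)))"
proof -
  interpret psd_resolution I lam M "\<lambda>i x. A i *v x"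
  proof (rule psd_resolution.intro)
    show "norm (A i *v x) \<le> M * norm x" if "i \<in> I" for i x
      using norm_matrix_vector_le_opnorm[of "A i" x] M that by (meson mult_right_mono norm_ge_zero order_trans)
    show "(\<Sum>i\<in>I. lam i *\<^sub>R (A i *v x)) = x" for x
      using res by (simp flip: scaleR_matrix_vector_mult sum_matrix_vector_mult)
  qed (use I sa psd in \<open>auto intro: matrix_vector_mul_linear\<close>)
  have D: "DIM('a^'d) = card Js * CARD('d)" using d by simp
  obtain idx where idx: "\<And>r. 1 \<le> r \<Longrightarrow> idx r \<in> I"
    and le: "\<And>k x. 1 \<le> k \<Longrightarrow> norm ((1 / real k) *\<^sub>R (\<Sum>r=1..k. A (idx r) *v x) - x) \<le>
      (if real k \<le> M * ln (2 * real CARD('d)) then 2 * (M * ln (2 * real CARD('d)) / real k)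
       else 3 * sqrt (M * ln (2 * real CARD('d)) / real k)) * norm x"
    using exists_approximating_sequence[OF Js comm ortho D] by blast
  have "opnorm ((1 / real k) *\<^sub>R (\<Sum>r=1..k. A (idx r)) - mat 1) \<le>
      (if real k \<le> M * ln (2 * real CARD('d)) then 2 * (M * ln (2 * real CARD('d)) / real k)
       else 3 * sqrt (M * ln (2 * real CARD('d)) / real k))" if "1 \<le> k" for k
    unfolding opnorm_def
  proof (rule onorm_le)
    fix x
    show "norm (((1 / real k) *\<^sub>R (\<Sum>r=1..k. A (idx r)) - mat 1) *v x) \<le>
      (if real k \<le> M * ln (2 * real CARD('d)) then 2 * (M * ln (2 * real CARD('d)) / real k)
       else 3 * sqrt (M * ln (2 * real CARD('d)) / real k)) * norm x"
      using le[OF that, of x]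
      by (simp only: matrix_vector_mult_diff_rdistrib scaleR_matrix_vector_mult sum_matrix_vector_mult
          matrix_vector_mul_lid)
  qed
  then show ?thesis using idx by blast
qed

lemma psd_real_inner:
  assumes "psd_real A"
  shows "(A *v x) \<bullet> y = x \<bullet> (A *v y)"
  using assms dot_lmul_matrix[of x A y] transpose_matrix_vector[of A x] by (simp add: psd_real_def)

lemma inner_complex_vec:
  fixes x y :: "complex^'d"
  shows "x \<bullet> y = Re (\<Sum>i\<in>UNIV. cnj (x $ i) * y $ i)"
  by (simp add: inner_vec_def inner_complex_def)

lemma psd_complex_inner:
  assumes "psd_complex A"
  shows "(A *v x) \<bullet> y = x \<bullet> (A *v y)"
proof -
  have cnj: "cnj (A $ i $ j) = A $ j $ i" for i j
    using assms by (simp add: psd_complex_def conj_transpose_def vec_eq_iff)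
  have "(\<Sum>i\<in>UNIV. cnj ((A *v x) $ i) * y $ i) = (\<Sum>i\<in>UNIV. \<Sum>j\<in>UNIV. A $ j $ i * cnj (x $ j) * y $ i)"
    by (simp add: matrix_vector_mult_def sum_distrib_right cnj)
  also have "\<dots> = (\<Sum>j\<in>UNIV. cnj (x $ j) * (A *v y) $ j)"
    by (subst sum.swap) (simp add: matrix_vector_mult_def sum_distrib_left mult_ac)
  finally show ?thesis by (simp only: inner_complex_vec)
qed

text \<open>For the real inner product, multiplication by \<open>\<i>\<close> is an isometry and
  sends every vector to an orthogonal one.\<close>

lemma inner_i_scale:
  fixes x :: "complex^'d"
  shows "(\<i> *s x) \<bullet> (\<i> *s x) = x \<bullet> x" "x \<bullet> (\<i> *s x) = 0" "(\<i> *s x) \<bullet> x = 0"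
  by (simp_all add: inner_vec_def inner_complex_def mult.commute add.commute)

theorem theorem1p1:
  fixes m :: nat and lam :: "nat \<Rightarrow> real" and M :: real
  assumes "m \<ge> 1"
    and "\<forall>i\<in>{1..m}. lam i \<ge> 0"
    and "(\<Sum>i=1..m. lam i) = 1"
  shows
    "(\<forall>A :: nat \<Rightarrow> real^'d^'d.
        (\<forall>i\<in>{1..m}. psd_real (A i)) \<and>
        (\<Sum>i=1..m. lam i *\<^sub>R A i) = mat 1 \<and>
        (\<forall>i\<in>{1..m}. opnorm (A i) \<le> M) \<longrightarrow>
        (\<exists>idx :: nat \<Rightarrow> nat.
           (\<forall>r\<ge>1. idx r \<in> {1..m}) \<and>
           (\<forall>k\<ge>1.
              opnorm ((1 / real k) *\<^sub>R (\<Sum>r=1..k. A (idx r)) - mat 1) \<le>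
                (if real k \<le> M * ln (2 * real CARD('d))
                 then 2 * (M * ln (2 * real CARD('d)) / real k)
                 else 3 * sqrt (M * ln (2 * real CARD('d)) / real k)))))
     \<and>
     (\<forall>A :: nat \<Rightarrow> complex^'d^'d.
        (\<forall>i\<in>{1..m}. psd_complex (A i)) \<and>
        (\<Sum>i=1..m. lam i *\<^sub>R A i) = mat 1 \<and>
        (\<forall>i\<in>{1..m}. opnorm (A i) \<le> M) \<longrightarrow>
        (\<exists>idx :: nat \<Rightarrow> nat.
           (\<forall>r\<ge>1. idx r \<in> {1..m}) \<and>
           (\<forall>k\<ge>1.
              opnorm ((1 / real k) *\<^sub>R (\<Sum>r=1..k. A (idx r)) - mat 1) \<le>
                (if real k \<le> M * ln (2 * real CARD('d))
                 then 2 * (M * ln (2 * real CARD('d)) / real k)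
                 else 3 * sqrt (M * ln (2 * real CARD('d)) / real k)))))"
proof (intro conjI allI impI; elim conjE)
  fix A :: "nat \<Rightarrow> real^'d^'d"
  assume A: "\<forall>i\<in>{1..m}. psd_real (A i)" "(\<Sum>i=1..m. lam i *\<^sub>R A i) = mat 1" "\<forall>i\<in>{1..m}. opnorm (A i) \<le> M"
  have psd: "0 \<le> x \<bullet> (A i *v x)" if "i \<in> {1..m}" for i x
    using A(1) that by (simp add: psd_real_def)
  show "\<exists>idx :: nat \<Rightarrow> nat. (\<forall>r\<ge>1. idx r \<in> {1..m}) \<and>
           (\<forall>k\<ge>1.
              opnorm ((1 / real k) *\<^sub>R (\<Sum>r=1..k. A (idx r)) - mat 1) \<le>
                (if real k \<le> M * ln (2 * real CARD('d))
                 then 2 * (M * ln (2 * real CARD('d)) / real k)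
                 else 3 * sqrt (M * ln (2 * real CARD('d)) / real k)))"
    by (rule exists_matrix_approximating_sequence[where Js = "{\<lambda>x. x}", OF _ assms(2,3) psd_real_inner psd A(3,2)])
      (use A(1) in \<open>auto simp: norm_eq_1 linear_ident\<close>)
next
  fix A :: "nat \<Rightarrow> complex^'d^'d"
  assume A: "\<forall>i\<in>{1..m}. psd_complex (A i)" "(\<Sum>i=1..m. lam i *\<^sub>R A i) = mat 1" "\<forall>i\<in>{1..m}. opnorm (A i) \<le> M"
  let ?id = "\<lambda>x :: complex^'d. x" and ?i = "\<lambda>x :: complex^'d. \<i> *s x"
  have psd: "0 \<le> x \<bullet> (A i *v x)" if "i \<in> {1..m}" for i x
    using A(1) that by (simp add: psd_complex_def inner_complex_vec)
  \<comment> \<open>The two maps must differ for \<open>Js\<close> to have two elements, the real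
    dimension of the complex numbers.\<close>
  have ne: "?id \<noteq> ?i" "?i \<noteq> ?id"
  proof -
    have "?id 1 $ i \<noteq> ?i 1 $ i" for i by (simp add: complex_eq_iff)
    then show "?id \<noteq> ?i" "?i \<noteq> ?id" by metis+
  qed
  have lin: "linear ?i" by (rule linearI) (simp_all add: vec_eq_iff algebra_simps)
  show "\<exists>idx :: nat \<Rightarrow> nat. (\<forall>r\<ge>1. idx r \<in> {1..m}) \<and>
           (\<forall>k\<ge>1.
              opnorm ((1 / real k) *\<^sub>R (\<Sum>r=1..k. A (idx r)) - mat 1) \<le>
                (if real k \<le> M * ln (2 * real CARD('d))
                 then 2 * (M * ln (2 * real CARD('d)) / real k)
                 else 3 * sqrt (M * ln (2 * real CARD('d)) / real k)))"
    by (rule exists_matrix_approximating_sequence[where Js = "{?id, ?i}", OF _ assms(2,3) psd_complex_inner psd A(3,2)])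
      (use A(1) ne lin in \<open>auto simp: norm_eq_1 linear_ident inner_i_scale vector_scalar_commute\<close>)
qed

end
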